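(* Let $f\in\mathcal{F}^p_{\lambda,a}(K)$ be of the form \[ f(x)=\lambda x+\sum_{i\ge i_0}a_ix^i \] for some integer $i_0>k'$, with conjugacy function $g$, and let $\rho=|1-\lambda^m|^{\frac1{mp}}/a$. Then the full conjugacy $g\circ f\circ g^{-1}(x)=\lambda x$ holds on a disc larger than or equal to the closed disc $\overline D_\rho(0)$ if $g$ converges on $\overline D_\rho(0)$, and on a disc larger than or equal to the open disc $D_\rho(0)$ if $g$ does not converge on $\overline D_\rho(0)$.
   Context: $K$ is a field of characteristic $p>0$, complete with respect to a nontrivial absolute value $|\cdot|$ (necessarily non-Archimedean); $D_r(0)=\{x\in K:|x|<r\}$, $\overline D_r(0)=\{x\in K:|x|\le r\}$. The element $\lambda\in K$ is not a root of unity and is such that $m=m(\lambda)=\min\{n\in\mathbb Z:n\ge1,\ |1-\lambda^n|<1\}$ exists (so $|\lambda|=1$; one has $p\nmid m$). $k'=k'(\lambda)=\min\{k\in\mathbb Z:k\ge1,\ p\mid k,\ m\mid k-1\}$. For a real number $a>0$, \[ \mathcal F^p_{\lambda,a}(K)=\Big\{\lambda x+\sum_{i\ge2,\ p\mid i}a_ix^i\in K[[x]]:\ a=\sup_{i\ge2}|a_i|^{1/(i-1)}\Big\}. \] The conjugacy function $g$ of $f$ is the unique power series solution, with $g(0)=0$ and $g'(0)=1$, of the Schröder functional equation $g\circ f(x)=\lambda g(x)$. The full conjugacy holds on a disc $U$ about $0$ if $g$ converges and is one-to-one on $U$, the compositional inverse power series $g^{-1}$ converges on $U$, and $g(f(g^{-1}(x)))=\lambda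 x$ for all $x\in U$. *)

theory Defs
  imports "HOL-Analysis.Analysis" "HOL-Computational_Algebra.Computational_Algebra"
begin

text \<open>
  Fields with a nontrivial absolute value. The class \<open>real_normed_field\<close> cannot be used, because it
  forces characteristic 0, and \<open>norm\<close> is constrained to real normed spaces. The ultrametric
  inequality is not assumed: in positive characteristic it follows from the axioms below.
\<close>

class abs_valued_field = field + metric_space +
  fixes absval :: "'a \<Rightarrow> real"
  assumes absval_nonneg: "absval x \<ge> 0"
    and absval_eq_0_iff: "absval x = 0 \<longleftrightarrow> x = 0"
    and absval_mult: "absval (x * y) = absval x * absval y"
    and absval_triangle: "absval (x + y) \<le> absval x + absval y"
    and absval_nontrivial: "\<exists>x. x \<noteq> 0 \<and> absval x \<noteq> 1"
    and dist_absval: "dist x y = absval (x - y)"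

text \<open>
  Evaluation of formal power series; \<open>eval_fps\<close> is restricted to real normed algebras. The value of
  \<open>fps_eval\<close> is only meaningful where the series is summable.
\<close>

definition fps_eval :: "'a :: abs_valued_field fps \<Rightarrow> 'a \<Rightarrow> 'a" where
  "fps_eval F x = (\<Sum>n. fps_nth F n * x ^ n)"

definition fps_converges_on :: "'a :: abs_valued_field fps \<Rightarrow> 'a set \<Rightarrow> bool" where
  "fps_converges_on F U \<longleftrightarrow> (\<forall>x\<in>U. summable (\<lambda>n. fps_nth F n * x ^ n))"

definition mult_index :: "'a :: abs_valued_field \<Rightarrow> nat" where
  "mult_index lam = (LEAST n. n \<ge> 1 \<and> absval (1 - lam ^ n) < 1)"

definition resonance_index :: "'a :: abs_valued_field \<Rightarrow> nat" where
  "resonance_index lam =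
     (LEAST k. k \<ge> 1 \<and> CHAR('a) dvd k \<and> mult_index lam dvd k - 1)"

text \<open>
  The boundedness condition is part of the equation for \<open>a\<close>: on the reals, \<open>Sup\<close> of an unbounded set
  is not meaningful.
\<close>

definition series_family :: "'a :: abs_valued_field \<Rightarrow> real \<Rightarrow> 'a fps set" where
  "series_family lam a = {f.
     fps_nth f 0 = 0 \<and> fps_nth f 1 = lam \<and>
     (\<forall>i\<ge>2. \<not> CHAR('a) dvd i \<longrightarrow> fps_nth f i = 0) \<and>
     bdd_above ((\<lambda>i. absval (fps_nth f i) powr (1 / (real i - 1))) ` {2..}) \<and>
     a = (SUP i\<in>{2..}. absval (fps_nth f i) powr (1 / (real i - 1)))}"

text \<open>Solutions of the Schroeder functional equation, normalised at the fixed point.\<close>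

definition is_conjugacy_function ::
  "'a :: abs_valued_field \<Rightarrow> 'a fps \<Rightarrow> 'a fps \<Rightarrow> bool" where
  "is_conjugacy_function lam f g \<longleftrightarrow>
     fps_nth g 0 = 0 \<and> fps_nth g 1 = 1 \<and> g oo f = fps_const lam * g"

definition disc_about_0 :: "'a :: abs_valued_field set \<Rightarrow> bool" where
  "disc_about_0 U \<longleftrightarrow> (\<exists>r>0. U = ball 0 r \<or> U = cball 0 r)"

text \<open>
  The equation \<open>g (f (g\<^sup>-\<^sup>1 x)) = lam * x\<close> concerns the iterated values of the three series. The two
  additional summability conditions say that these values exist.
\<close>

definition full_conjugacy_on ::
  "'a :: abs_valued_field \<Rightarrow> 'a fps \<Rightarrow> 'a fps \<Rightarrow> 'a set \<Rightarrow> bool" where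
  "full_conjugacy_on lam f g U \<longleftrightarrow>
     fps_converges_on g U \<and> inj_on (fps_eval g) U \<and> fps_converges_on (fps_inv g) U \<and>
     (\<forall>x\<in>U. fps_converges_on f {fps_eval (fps_inv g) x} \<and>
        fps_converges_on g {fps_eval f (fps_eval (fps_inv g) x)} \<and>
        fps_eval g (fps_eval f (fps_eval (fps_inv g) x)) = lam * x)"

end

theory Submission
  imports Defs "HOL-Number_Theory.Cong"
begin

text \<open>
  Write \<open>p\<close> for the characteristic, \<open>m\<close> for the multiplicative index of \<open>\<lambda>\<close>, \<open>k'\<close> for the resonance index
  and \<open>\<epsilon> = |1 - \<lambda>\<^sup>m|\<close>, so that \<open>(a \<rho>)\<^bsup>m p\<^esup> = \<epsilon>\<close>.

  The functional equation determines \<open>g\<^sub>n\<close> from the lower coefficients after division by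
  \<open>\<lambda> (1 - \<lambda>\<^bsup>n-1\<^esup>)\<close>, and the point is that small divisors are rare and not very small. As \<open>f\<close> has
  derivative \<open>\<lambda>\<close>, the derivative of \<open>g\<close> is invariant under \<open>f\<close> and therefore equal to \<open>1\<close>: beyond the linear
  term, only exponents divisible by \<open>p\<close> occur in \<open>g\<close> (\<open>conjugacy_function_coeff_eq_0\<close>). For such \<open>n\<close> the prime
  \<open>p\<close> does not divide \<open>n - 1\<close>, so the divisor has size \<open>\<epsilon>\<close> if \<open>m\<close> divides \<open>n - 1\<close>, and size 1 otherwise
  (\<open>small_divisor\<close>). The first case means that \<open>n\<close> is congruent to \<open>k'\<close> modulo \<open>m p\<close>. Because \<open>f\<close> has no
  nonlinear terms up to \<open>k'\<close>, at most \<open>(n - k') / (m p)\<close> factors \<open>1/\<epsilon>\<close> accumulate in \<open>g\<^sub>n\<close>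
  (\<open>conjugacy_function_coeff_bound\<close>), whereas \<open>(a \<rho>)\<^bsup>n-1\<^esup>\<close> is worth \<open>(n - 1) / (m p)\<close> factors \<open>\<epsilon>\<close>. Since
  \<open>k' > 1\<close>, this gives \<open>|g\<^sub>n| \<rho>\<^bsup>n-1\<^esup> \<le> d\<close> for all \<open>n \<ge> 2\<close> with the single constant
  \<open>d = (a \<rho>)\<^bsup>k'-1\<^esup> < 1\<close>.

  Hence \<open>g\<close> converges on the open disc of radius \<open>\<rho>\<close>, and on any disc of radius at most \<open>\<rho>\<close> on
  which \<open>g\<close> converges it is a perturbation of the identity by the factor \<open>d\<close>. The inverse series then
  converges at the same points, also on the boundary of the disc (\<open>inverse_near_identity\<close>). Finally, the identities
  between the power series pass to values, because composites can be evaluated termwise (\<open>sums_fps_compose\<close>).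
  All of this is done one point \<open>x\<close> at a time with the Gauss norm of radius \<open>|x|\<close>, which treats open and closed
  discs alike. The two discs of the conclusion are the discs of radius \<open>\<rho>\<close> themselves.
\<close>

section \<open>Absolute values\<close>

lemma absval_0 [simp]: "absval (0::'a::abs_valued_field) = 0"
  by (simp add: absval_eq_0_iff)

lemma absval_1 [simp]: "absval (1::'a::abs_valued_field) = 1"
  using absval_mult[of "1::'a" 1] absval_eq_0_iff[of "1::'a"] by simp

lemma absval_power: "absval ((x::'a::abs_valued_field) ^ n) = absval x ^ n"
  by (induction n) (simp_all add: absval_mult)

lemma absval_minus [simp]: "absval (- x) = absval (x::'a::abs_valued_field)"
proof -
  have "absval (-1::'a) ^ 2 = 1"
    by (simp flip: absval_power)
  then have "absval (-1::'a) = 1"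
    using absval_nonneg[of "-1::'a"] by (simp add: power2_eq_1_iff)
  then show ?thesis
    using absval_mult[of "-1" x] by simp
qed

lemma absval_minus_commute: "absval (x - y) = absval (y - (x::'a::abs_valued_field))"
  using absval_minus[of "x - y"] by simp

lemma absval_eq_dist_0: "absval x = dist x (0::'a::abs_valued_field)"
  by (simp add: dist_absval)

lemma absval_pos: "x \<noteq> 0 \<Longrightarrow> 0 < absval (x::'a::abs_valued_field)"
  using absval_nonneg[of x] absval_eq_0_iff[of x] by linarith

lemma tendsto_iff_absval:
  fixes f :: "'b \<Rightarrow> 'a::abs_valued_field"
  shows "(f \<longlongrightarrow> l) F \<longleftrightarrow> ((\<lambda>x. absval (f x - l)) \<longlongrightarrow> 0) F"
  by (subst tendsto_dist_iff) (simp add: dist_absval)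

instance abs_valued_field \<subseteq> topological_ab_group_add
proof
  fix a b :: 'a
  show "LIM x (nhds a \<times>\<^sub>F nhds b). fst x + snd x :> nhds (a + b)"
    unfolding tendsto_iff_absval[of "\<lambda>x. fst x + snd x"]
  proof (rule tendsto_0_le[where K = 1])
    have f: "filterlim fst (nhds a) (nhds a \<times>\<^sub>F nhds b)" "filterlim snd (nhds b) (nhds a \<times>\<^sub>F nhds b)"
      by (rule filterlim_fst filterlim_snd)+
    have "((\<lambda>x. absval (fst x - a) + absval (snd x - b)) \<longlongrightarrow> 0 + 0) (nhds a \<times>\<^sub>F nhds b)"
      by (intro tendsto_add) (use f in \<open>simp_all add: tendsto_iff_absval\<close>)
    then show "((\<lambda>x. absval (fst x - a) + absval (snd x - b)) \<longlongrightarrow> 0) (nhds a \<times>\<^sub>F nhds b)"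
      by simp
    have "absval (fst x + snd x - (a + b)) \<le> absval (fst x - a) + absval (snd x - b)" for x
      using absval_triangle[of "fst x - a" "snd x - b"] by (simp add: algebra_simps)
    then show "\<forall>\<^sub>F x in nhds a \<times>\<^sub>F nhds b. norm (absval (fst x + snd x - (a + b)))
        \<le> norm (absval (fst x - a) + absval (snd x - b)) * 1"
      by (simp add: absval_nonneg)
  qed
  show "(uminus \<longlongrightarrow> - a) (nhds a)"
  proof -
    have "((\<lambda>x. x) \<longlongrightarrow> a) (nhds a)"
      by (simp add: filterlim_ident)
    then show ?thesis
      unfolding tendsto_iff_absval by (simp add: absval_minus_commute)
  qed
qed

lemma sums_cmult:
  fixes f :: "nat \<Rightarrow> 'a::abs_valued_field"
  assumes "f sums s"
  shows "(\<lambda>n. c * f n) sums (c * s)"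
proof -
  have "(\<lambda>N. absval c * absval ((\<Sum>n<N. f n) - s)) \<longlonglongrightarrow> absval c * 0"
    using assms unfolding sums_def tendsto_iff_absval by (intro tendsto_intros)
  then show ?thesis
    unfolding sums_def by (subst tendsto_iff_absval)
      (simp add: absval_mult flip: sum_distrib_left right_diff_distrib)
qed

lemma absval_tendsto_0_of_summable:
  fixes f :: "nat \<Rightarrow> 'a::abs_valued_field"
  assumes "summable f"
  shows "(\<lambda>n. absval (f n)) \<longlonglongrightarrow> 0"
proof -
  obtain s where "(\<lambda>N. \<Sum>n<N. f n) \<longlonglongrightarrow> s"
    using assms by (auto simp: summable_def sums_def)
  then have "(\<lambda>N. (\<Sum>n<Suc N. f n) - (\<Sum>n<N. f n)) \<longlonglongrightarrow> s - s"
    by (intro tendsto_diff LIMSEQ_Suc)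
  then show ?thesis
    by (simp add: tendsto_iff_absval)
qed

lemma sums_shift:
  fixes f :: "nat \<Rightarrow> 'a::abs_valued_field"
  assumes "f sums s"
  shows "(\<lambda>n. if i \<le> n then f (n - i) else 0) sums s"
proof -
  have "(\<Sum>n<N + i. if i \<le> n then f (n - i) else 0) = (\<Sum>n<N. f n)" for N
    by (induction N) simp_all
  then have "(\<lambda>N. \<Sum>n<N + i. if i \<le> n then f (n - i) else 0) \<longlonglongrightarrow> s"
    using assms by (simp add: sums_def)
  then show ?thesis
    unfolding sums_def by (rule LIMSEQ_offset)
qed

text \<open>
  Put \<open>q = p\<^sup>s\<close> and let \<open>M\<close> be the larger of \<open>|x|\<close> and \<open>|y|\<close>. Since raising to the power \<open>q\<close> is additive in
  characteristic \<open>p\<close>, the \<open>q\<close>-th power of \<open>|x + y|\<close> is at most \<open>2 M\<^sup>q\<close>. A quotient \<open>|x + y| / M > 1\<close> would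
  have unbounded powers.
\<close>

lemma absval_ultrametric:
  fixes x y :: "'a::abs_valued_field"
  assumes "CHAR('a) > 0"
  shows "absval (x + y) \<le> max (absval x) (absval y)"
proof (rule ccontr)
  define M where "M = max (absval x) (absval y)"
  have p: "prime CHAR('a)"
    using assms by (rule prime_CHAR_semidom)
  assume "\<not> ?thesis"
  then have less: "M < absval (x + y)"
    by (auto simp: M_def)
  have "0 \<le> M"
    by (simp add: M_def absval_nonneg le_max_iff_disj)
  with less absval_triangle[of x y] have "0 < M"
    unfolding M_def by linarith
  define q where "q = absval (x + y) / M"
  have "q > 1"
    using less \<open>0 < M\<close> by (simp add: q_def)
  have bounded: "q ^ (CHAR('a) ^ s) \<le> 2" for s
  proof -
    let ?n = "CHAR('a) ^ s"
    have "absval (x + y) ^ ?n = absval (x ^ ?n + y ^ ?n)"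
      by (simp flip: absval_power freshmans_dream'[OF p refl])
    also have "\<dots> \<le> absval x ^ ?n + absval y ^ ?n"
      by (rule order_trans[OF absval_triangle]) (simp add: absval_power)
    also have "\<dots> \<le> M ^ ?n + M ^ ?n"
      by (intro add_mono power_mono) (simp_all add: M_def absval_nonneg)
    finally show ?thesis
      using \<open>0 < M\<close> by (simp add: q_def power_divide field_simps)
  qed
  obtain n where "2 < q ^ n"
    using \<open>q > 1\<close> real_arch_pow by blast
  also have "q ^ n \<le> q ^ (CHAR('a) ^ n)"
    using \<open>q > 1\<close> prime_gt_1_nat[OF p] by (intro power_increasing) (auto intro: less_imp_le power_gt_expt)
  finally show False
    using bounded[of n] by simp
qed

section \<open>Series over an ultrametric field\<close>

context
  assumes ultrametric: "\<And>x y :: 'a::abs_valued_field. absval (x + y) \<le> max (absval x) (absval y)"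
begin

lemma absval_diff_le_max: "absval (x - y :: 'a) \<le> max (absval x) (absval y)"
  using ultrametric[of x "- y"] by simp

lemma absval_sum_le:
  fixes f :: "'b \<Rightarrow> 'a"
  assumes "\<And>i. i \<in> A \<Longrightarrow> absval (f i) \<le> c" "0 \<le> c"
  shows "absval (sum f A) \<le> c"
proof (cases "finite A")
  case True
  then show ?thesis
    using assms
  proof (induction A rule: finite_induct)
    case (insert i A)
    have "absval (f i + sum f A) \<le> max (absval (f i)) (absval (sum f A))"
      by (rule ultrametric)
    then show ?case
      using insert by (simp add: le_max_iff_disj) force
  qed simp
qed (use assms in simp)

lemma absval_sums_le:
  fixes f :: "nat \<Rightarrow> 'a"
  assumes "f sums s" "\<And>n. absval (f n) \<le> c" "0 \<le> c"
  shows "absval s \<le> c"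
proof -
  have "(\<lambda>N. absval (\<Sum>n<N. f n)) \<longlonglongrightarrow> absval s"
    using assms(1) unfolding sums_def absval_eq_dist_0 by (intro tendsto_intros)
  then show ?thesis
    by (rule tendsto_upperbound) (use assms in \<open>auto intro!: always_eventually absval_sum_le\<close>)
qed

text \<open>
  The domination \<open>c\<close> makes the tails in \<open>l\<close> uniformly small in \<open>n\<close>, since a sum is no larger than its
  largest term; the vanishing below the diagonal makes every inner sum finite.
\<close>

lemma sums_exchange:
  fixes w :: "nat \<Rightarrow> nat \<Rightarrow> 'a"
  assumes row: "\<And>l. w l sums t l" and total: "t sums s"
    and dom: "\<And>l n. absval (w l n) \<le> c l" and c: "c \<longlonglongrightarrow> 0"
    and diag: "\<And>l n. n < l \<Longrightarrow> w l n = 0"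
  shows "(\<lambda>n. \<Sum>l\<le>n. w l n) sums s"
  unfolding sums_def tendsto_iff_absval
proof (rule LIMSEQ_I, goal_cases)
  case (1 e)
  obtain L1 where L1: "\<And>l. l \<ge> L1 \<Longrightarrow> \<bar>c l\<bar> < e / 2"
    using LIMSEQ_D[OF c, of "e / 2"] \<open>0 < e\<close> by auto
  obtain L2 where L2: "\<And>M. M \<ge> L2 \<Longrightarrow> absval ((\<Sum>l<M. t l) - s) < e"
    using LIMSEQ_D[of "\<lambda>M. absval ((\<Sum>l<M. t l) - s)" 0 e] total \<open>0 < e\<close>
    unfolding sums_def tendsto_iff_absval[of "\<lambda>M. \<Sum>l<M. t l"] by (auto simp: absval_nonneg)
  define L where "L = max L1 L2"
  have "(\<lambda>N. \<Sum>l<L. \<Sum>n<N. w l n) \<longlonglongrightarrow> (\<Sum>l<L. t l)"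
    using row unfolding sums_def by (intro tendsto_sum)
  then obtain N1 where
    N1: "\<And>N. N \<ge> N1 \<Longrightarrow> absval ((\<Sum>l<L. \<Sum>n<N. w l n) - (\<Sum>l<L. t l)) < e"
    using LIMSEQ_D[of "\<lambda>N. absval ((\<Sum>l<L. \<Sum>n<N. w l n) - (\<Sum>l<L. t l))" 0 e] \<open>0 < e\<close>
    unfolding tendsto_iff_absval[of "\<lambda>N. \<Sum>l<L. \<Sum>n<N. w l n"] by (auto simp: absval_nonneg)
  have "absval ((\<Sum>n<N. \<Sum>l\<le>n. w l n) - s) < e" if N: "N \<ge> max L N1" for N
  proof -
    have "(\<Sum>n<N. \<Sum>l\<le>n. w l n) = (\<Sum>n<N. \<Sum>l<N. w l n)"
      by (intro sum.cong sum.mono_neutral_left) (auto intro: diag)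
    also have "\<dots> = (\<Sum>l<N. \<Sum>n<N. w l n)"
      by (rule sum.swap)
    also have "\<dots> = (\<Sum>l<L. \<Sum>n<N. w l n) + (\<Sum>l=L..<N. \<Sum>n<N. w l n)"
      using N by (simp add: lessThan_atLeast0 sum.atLeastLessThan_concat)
    finally have split: "(\<Sum>n<N. \<Sum>l\<le>n. w l n) - s =
        ((\<Sum>l<L. \<Sum>n<N. w l n) - (\<Sum>l<L. t l)) + (((\<Sum>l<L. t l) - s) + (\<Sum>l=L..<N. \<Sum>n<N. w l n))"
      by simp
    have "absval (w l n) \<le> e / 2" if "l \<ge> L" for l n
      using dom[of l n] L1[of l] that by (simp add: L_def)
    then have "absval (\<Sum>l=L..<N. \<Sum>n<N. w l n) \<le> e / 2"
      using \<open>0 < e\<close> by (intro absval_sum_le) auto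
    moreover have "absval ((\<Sum>l<L. \<Sum>n<N. w l n) - (\<Sum>l<L. t l)) < e"
      using N1 N by simp
    moreover have "absval ((\<Sum>l<L. t l) - s) < e"
      by (rule L2) (simp add: L_def)
    ultimately show ?thesis
      unfolding split using \<open>0 < e\<close> ultrametric
      by (intro le_less_trans[OF ultrametric] max_less_iff_conj[THEN iffD2] conjI) linarith+
  qed
  then show ?case
    by (intro exI[of _ "max L N1"]) (auto simp: absval_nonneg)
qed

lemma sums_fps_mult:
  fixes F G :: "'a fps"
  assumes F: "(\<lambda>n. fps_nth F n * x ^ n) sums s" and G: "(\<lambda>n. fps_nth G n * x ^ n) sums t"
  shows "(\<lambda>n. fps_nth (F * G) n * x ^ n) sums (s * t)"
proof -
  define w where "w l n = fps_nth F l * x ^ l * (if l \<le> n then fps_nth G (n - l) * x ^ (n - l) else 0)" for l n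
  have lim: "(\<lambda>n. absval (fps_nth F n * x ^ n)) \<longlonglongrightarrow> 0" "(\<lambda>n. absval (fps_nth G n * x ^ n)) \<longlonglongrightarrow> 0"
    using F G by (auto intro!: absval_tendsto_0_of_summable sums_summable)
  obtain B where B: "B > 0" "\<And>n. absval (fps_nth G n * x ^ n) \<le> B"
    using convergent_imp_Bseq[OF convergentI[OF lim(2)]] by (auto simp: Bseq_def absval_nonneg)
  have "(\<lambda>n. \<Sum>l\<le>n. w l n) sums (t * s)"
  proof (rule sums_exchange)
    show "w l sums (fps_nth F l * x ^ l * t)" for l
      unfolding w_def by (intro sums_cmult sums_shift G)
    show "(\<lambda>l. fps_nth F l * x ^ l * t) sums (t * s)"
      using sums_cmult[OF F, of t] by (simp add: mult_ac)
    show "absval (w l n) \<le> absval (fps_nth F l * x ^ l) * B" for l n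
      unfolding w_def absval_mult[of "fps_nth F l * x ^ l"]
      using B by (intro mult_left_mono absval_nonneg) (auto intro: less_imp_le)
    show "(\<lambda>l. absval (fps_nth F l * x ^ l) * B) \<longlonglongrightarrow> 0"
      using tendsto_mult_right[OF lim(1), of B] by simp
  qed (simp add: w_def)
  moreover have "(\<Sum>l\<le>n. w l n) = fps_nth (F * G) n * x ^ n" for n
  proof -
    have "w l n = fps_nth F l * fps_nth G (n - l) * x ^ n" if "l \<le> n" for l
      using that power_add[of x l "n - l"] by (simp add: w_def mult_ac)
    then show ?thesis
      by (simp add: fps_mult_nth sum_distrib_right atMost_atLeast0)
  qed
  ultimately show ?thesis
    by (simp add: mult.commute)
qed

lemma sums_fps_power:
  fixes F :: "'a fps"
  assumes "(\<lambda>n. fps_nth F n * x ^ n) sums s"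
  shows "(\<lambda>n. fps_nth (F ^ k) n * x ^ n) sums (s ^ k)"
proof (induction k)
  case 0
  have "(\<lambda>n. fps_nth (1 :: 'a fps) n * x ^ n) = (\<lambda>n. if n = 0 then 1 else 0)"
    by auto
  then show ?case
    using sums_single[of 0 "\<lambda>_. 1 :: 'a"] by simp
qed (simp add: sums_fps_mult[OF assms])

text \<open>The Gauss norm of radius \<open>r\<close>, the supremum of \<open>|F\<^sub>n| r\<^sup>n\<close>, is submultiplicative.\<close>

lemma gauss_norm_mult_le:
  fixes F G :: "'a fps"
  assumes "0 \<le> r" "0 \<le> A"
    and F: "\<And>n. absval (fps_nth F n) * r ^ n \<le> A" and G: "\<And>n. absval (fps_nth G n) * r ^ n \<le> B"
  shows "absval (fps_nth (F * G) n) * r ^ n \<le> A * B"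
proof (cases "r = 0")
  case True
  have AB: "absval (fps_nth F 0) \<le> A" "absval (fps_nth G 0) \<le> B"
    using F[of 0] G[of 0] by simp_all
  then have "0 \<le> B"
    using absval_nonneg[of "fps_nth G 0"] by linarith
  then show ?thesis
    using True AB assms(2)
    by (cases n) (auto simp: fps_mult_nth absval_mult intro!: mult_mono absval_nonneg)
next
  case False
  with assms have "0 < r" by simp
  have "0 \<le> B"
    using G[of 0] absval_nonneg[of "fps_nth G 0"] by simp
  have "absval (fps_nth F i * fps_nth G (n - i)) \<le> A * B / r ^ n" if "i \<le> n" for i
  proof -
    have "absval (fps_nth F i * fps_nth G (n - i)) * r ^ n
        = (absval (fps_nth F i) * r ^ i) * (absval (fps_nth G (n - i)) * r ^ (n - i))"
      using that power_add[of r i "n - i"] by (simp add: absval_mult mult_ac)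
    also have "\<dots> \<le> A * B"
      by (intro mult_mono F G assms) (simp add: absval_nonneg assms)
    finally show ?thesis
      using \<open>0 < r\<close> by (simp add: field_simps)
  qed
  then have "absval (fps_nth (F * G) n) \<le> A * B / r ^ n"
    unfolding fps_mult_nth using assms \<open>0 \<le> B\<close> by (intro absval_sum_le) auto
  then show ?thesis
    using \<open>0 < r\<close> by (simp add: field_simps)
qed

lemma gauss_norm_power_le:
  fixes F :: "'a fps"
  assumes "0 \<le> r" "0 \<le> A" and F: "\<And>n. absval (fps_nth F n) * r ^ n \<le> A"
  shows "absval (fps_nth (F ^ k) n) * r ^ n \<le> A ^ k"
proof (induction k arbitrary: n)
  case (Suc k)
  then show ?case
    using gauss_norm_mult_le[OF assms, of "F ^ k" "A ^ k"] by simp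
qed (cases n; simp)

text \<open>
  The terms of \<open>F (H x)\<close>, expanded in powers of \<open>x\<close>, form a double series; the row of \<open>H\<^sup>l\<close> is
  dominated by \<open>|F\<^sub>l| R\<^sup>l\<close>, because \<open>R\<close> bounds the Gauss norm of \<open>H\<close> at the radius \<open>|x|\<close>.
\<close>

lemma sums_fps_compose:
  fixes F H :: "'a fps"
  assumes "fps_nth H 0 = 0" "0 \<le> R"
    and H: "(\<lambda>n. fps_nth H n * x ^ n) sums s"
    and bound: "\<And>n. absval (fps_nth H n * x ^ n) \<le> R"
    and null: "(\<lambda>l. absval (fps_nth F l) * R ^ l) \<longlonglongrightarrow> 0"
    and F: "(\<lambda>l. fps_nth F l * s ^ l) sums t"
  shows "(\<lambda>n. fps_nth (F oo H) n * x ^ n) sums t"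
proof -
  have "(\<lambda>n. \<Sum>l\<le>n. fps_nth F l * (fps_nth (H ^ l) n * x ^ n)) sums t"
  proof (rule sums_exchange)
    show "(\<lambda>n. fps_nth F l * (fps_nth (H ^ l) n * x ^ n)) sums (fps_nth F l * s ^ l)" for l
      by (intro sums_cmult sums_fps_power H)
    have "absval (fps_nth (H ^ l) n) * absval x ^ n \<le> R ^ l" for l n
      using bound by (intro gauss_norm_power_le) (simp_all add: absval_nonneg absval_mult absval_power assms)
    then show "absval (fps_nth F l * (fps_nth (H ^ l) n * x ^ n)) \<le> absval (fps_nth F l) * R ^ l" for l n
      by (simp add: absval_mult absval_power mult_left_mono absval_nonneg)
    show "fps_nth F l * (fps_nth (H ^ l) n * x ^ n) = 0" if "n < l" for l n
      using startsby_zero_power_prefix[OF assms(1), of l] that by simp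
  qed (rule F null)+
  then show ?thesis
    by (simp add: fps_compose_nth sum_distrib_right atMost_atLeast0 mult.assoc)
qed

section \<open>Inverting a series close to the identity\<close>

text \<open>
  In the Gauss norm of radius \<open>r\<close>, the series \<open>g\<close> lies within \<open>d r\<close> of \<open>X\<close>, so \<open>g\<^sup>l\<close> lies within
  \<open>d r\<^sup>l\<close> of \<open>X\<^sup>l\<close>, which has no coefficients beyond \<open>l\<close>.
\<close>

lemma near_identity_power:
  fixes g :: "'a fps"
  assumes g: "fps_nth g 0 = 0" "fps_nth g 1 = 1" and "0 \<le> r" "0 \<le> d" "d \<le> 1"
    and near: "\<And>n. n \<ge> 2 \<Longrightarrow> absval (fps_nth g n) * r ^ n \<le> d * r"
    and "l < n"
  shows "absval (fps_nth (g ^ l) n) * r ^ n \<le> d * r ^ l"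
  using \<open>l < n\<close>
proof (induction l arbitrary: n)
  case 0
  then show ?case
    by (simp add: assms)
next
  case (Suc l)
  have "d * r \<le> r"
    using assms by (simp add: mult_left_le_one_le)
  have gr: "absval (fps_nth g n) * r ^ n \<le> r" for n
  proof -
    consider "n = 0" | "n = 1" | "n \<ge> 2" by linarith
    then show ?thesis
      by cases (use g near[of n] \<open>d * r \<le> r\<close> assms(3) in auto)
  qed
  have summand: "absval (fps_nth g i * fps_nth (g ^ l) (n - i)) * r ^ n \<le> d * r ^ Suc l" if "i \<le> n" for i
  proof -
    have split: "absval (fps_nth g i * fps_nth (g ^ l) (n - i)) * r ^ n
        = (absval (fps_nth g i) * r ^ i) * (absval (fps_nth (g ^ l) (n - i)) * r ^ (n - i))"
      using that power_add[of r i "n - i"] by (simp add: absval_mult mult_ac)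
    consider "i = 0" | "i = 1" | "i \<ge> 2" by linarith
    then show ?thesis
    proof cases
      case 2
      then show ?thesis
        unfolding split
        using mult_left_mono[OF Suc.IH[of "n - 1"], of r] Suc.prems g assms(3) by (simp add: mult_ac)
    next
      case 3
      have "(absval (fps_nth g i) * r ^ i) * (absval (fps_nth (g ^ l) (n - i)) * r ^ (n - i)) \<le> (d * r) * r ^ l"
        by (intro mult_mono near[OF 3] gauss_norm_power_le[OF assms(3) assms(3) gr]
            mult_nonneg_nonneg zero_le_power absval_nonneg assms)
      then show ?thesis
        unfolding split by (simp add: mult_ac)
    qed (use g assms in simp)
  qed
  show ?case
  proof (cases "r = 0")
    case False
    with assms have "0 < r" by simp
    have "absval (fps_nth (g ^ Suc l) n) \<le> d * r ^ Suc l / r ^ n"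
      unfolding power_Suc[of g] fps_mult_nth using summand \<open>0 < r\<close> assms
      by (intro absval_sum_le) (auto simp: field_simps)
    then show ?thesis
      using \<open>0 < r\<close> by (simp add: field_simps)
  qed (use Suc.prems in \<open>simp add: power_0_left\<close>)
qed

text \<open>
  The coefficients of the inverse satisfy \<open>h\<^sub>n = - (\<Sum>l<n. h\<^sub>l [x\<^sup>n] g\<^sup>l)\<close>, where every \<open>[x\<^sup>n] g\<^sup>l\<close> is
  small by the factor \<open>d < 1\<close> and tends to \<open>0\<close> with \<open>n\<close>. A bound for almost all \<open>h\<^sub>n\<close> therefore improves
  by the factor \<open>d\<close> once the finitely many exceptional \<open>l\<close> contribute nothing, and iterating this
  gives convergence also on the boundary of the disc.
\<close>

lemma inverse_near_identity:
  fixes g h :: "'a fps"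
  assumes g: "fps_nth g 0 = 0" "fps_nth g 1 = 1" and h: "h oo g = fps_X"
    and "0 \<le> d" "d < 1"
    and near: "\<And>n. n \<ge> 2 \<Longrightarrow> absval (fps_nth g n * x ^ n) \<le> d * absval x"
    and conv: "(\<lambda>n. fps_nth g n * x ^ n) sums s"
  shows "absval (fps_nth h n * x ^ n) \<le> absval x"
    and "(\<lambda>n. absval (fps_nth h n * x ^ n)) \<longlonglongrightarrow> 0"
proof -
  let ?r = "absval x"
  have near': "absval (fps_nth g n) * ?r ^ n \<le> d * ?r" if "n \<ge> 2" for n
    using near[OF that] by (simp add: absval_mult absval_power)
  note pow = near_identity_power[OF g absval_nonneg \<open>0 \<le> d\<close> less_imp_le[OF \<open>d < 1\<close>] near']
  have h0: "fps_nth h 0 = 0"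
    using arg_cong[OF h, of "\<lambda>F. fps_nth F 0"] by simp
  have h1: "fps_nth h 1 = 1"
    using arg_cong[OF h, of "\<lambda>F. fps_nth F 1"] g h0 by (simp add: fps_compose_nth)
  have rec: "fps_nth h n = - (\<Sum>l<n. fps_nth h l * fps_nth (g ^ l) n)" if "n \<ge> 2" for n
  proof -
    have "0 = (\<Sum>l\<le>n. fps_nth h l * fps_nth (g ^ l) n)"
      using arg_cong[OF h, of "\<lambda>F. fps_nth F n"] that by (simp add: fps_compose_nth atMost_atLeast0)
    also have "\<dots> = (\<Sum>l<n. fps_nth h l * fps_nth (g ^ l) n) + fps_nth h n"
      by (simp add: lessThan_Suc_atMost[symmetric] startsby_zero_power_nth_same[OF g(1)] g(2)[simplified])
    finally show ?thesis
      by (simp add: eq_neg_iff_add_eq_0 add.commute)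
  qed
  have step: "absval (fps_nth h n * x ^ n) \<le> c"
    if "n \<ge> 2" "0 \<le> c" "\<And>l. l < n \<Longrightarrow> absval (fps_nth h l * fps_nth (g ^ l) n * x ^ n) \<le> c" for n c
    unfolding rec[OF \<open>n \<ge> 2\<close>] using that
    by (auto simp: sum_distrib_right intro!: absval_sum_le)
  have key: "absval (fps_nth h l * fps_nth (g ^ l) n * x ^ n) \<le> d * absval (fps_nth h l * x ^ l)"
    if "l < n" for l n
    using mult_left_mono[OF pow[OF _ that] absval_nonneg[of "fps_nth h l"]]
    by (simp add: absval_mult absval_power mult_ac)
  have "absval (fps_nth h n * x ^ n) \<le> ?r" for n
  proof (induction n rule: less_induct)
    case (less n)
    consider "n = 0" | "n = 1" | "n \<ge> 2" by linarith
    then show ?case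
    proof cases
      case 3
      show ?thesis
      proof (rule step[OF 3 absval_nonneg])
        fix l assume "l < n"
        have "d * absval (fps_nth h l * x ^ l) \<le> 1 * ?r"
          using less[OF \<open>l < n\<close>] assms by (intro mult_mono) (simp_all add: absval_nonneg)
        then show "absval (fps_nth h l * fps_nth (g ^ l) n * x ^ n) \<le> ?r"
          using key[OF \<open>l < n\<close>] by simp
      qed
    qed (use h0 h1 absval_nonneg in simp_all)
  qed
  note bound = this
  then show "absval (fps_nth h n * x ^ n) \<le> ?r" .
  have improve: "\<forall>\<^sub>F n in sequentially. absval (fps_nth h n * x ^ n) \<le> d * c"
    if "0 < d * c" and c: "\<forall>\<^sub>F n in sequentially. absval (fps_nth h n * x ^ n) \<le> c" for c
  proof -
    obtain L where L: "\<And>l. l \<ge> L \<Longrightarrow> absval (fps_nth h l * x ^ l) \<le> c"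
      using c by (auto simp: eventually_sequentially)
    have "(\<lambda>n. absval (fps_nth h l) * absval (fps_nth (g ^ l) n * x ^ n)) \<longlonglongrightarrow> absval (fps_nth h l) * 0" for l
      by (intro tendsto_mult_left absval_tendsto_0_of_summable sums_summable[OF sums_fps_power[OF conv]])
    then have "\<forall>\<^sub>F n in sequentially. absval (fps_nth h l * fps_nth (g ^ l) n * x ^ n) < d * c" for l
      using order_tendstoD(2)[of _ 0 sequentially "d * c"] \<open>0 < d * c\<close> by (simp add: absval_mult mult_ac)
    then have "\<forall>\<^sub>F n in sequentially. \<forall>l\<in>{..<L}. absval (fps_nth h l * fps_nth (g ^ l) n * x ^ n) < d * c"
      by (intro eventually_ball_finite) auto
    then show ?thesis
      using eventually_ge_at_top[of 2]
    proof eventually_elim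
      case (elim n)
      show ?case
      proof (rule step)
        show "absval (fps_nth h l * fps_nth (g ^ l) n * x ^ n) \<le> d * c" if "l < n" for l
        proof (cases "l < L")
          case False
          then have "d * absval (fps_nth h l * x ^ l) \<le> d * c"
            using L \<open>0 \<le> d\<close> by (intro mult_left_mono) simp_all
          then show ?thesis
            using key[OF that] by linarith
        qed (use elim in \<open>auto intro: less_imp_le\<close>)
      qed (use elim \<open>0 < d * c\<close> in auto)
    qed
  qed
  show "(\<lambda>n. absval (fps_nth h n * x ^ n)) \<longlonglongrightarrow> 0"
  proof (cases "d * ?r = 0")
    case True
    have "absval (fps_nth h n * x ^ n) = 0" if "n \<ge> 2" for n
    proof (rule antisym[OF step[OF that] absval_nonneg])
      fix l assume "l < n"
      have "d * absval (fps_nth h l * x ^ l) \<le> d * ?r"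
        using bound \<open>0 \<le> d\<close> by (intro mult_left_mono)
      then show "absval (fps_nth h l * fps_nth (g ^ l) n * x ^ n) \<le> 0"
        using key[OF \<open>l < n\<close>] True by simp
    qed simp
    then show ?thesis
      by (intro tendsto_eventually eventually_sequentiallyI[of 2])
  next
    case False
    with assms absval_nonneg[of x] have "0 < d" "0 < ?r" by (auto simp: less_le)
    have ev: "\<forall>\<^sub>F n in sequentially. absval (fps_nth h n * x ^ n) \<le> d ^ j * ?r" for j
    proof (induction j)
      case (Suc j)
      then show ?case
        using improve[of "d ^ j * ?r"] \<open>0 < d\<close> \<open>0 < ?r\<close> by (simp add: mult.assoc)
    qed (simp add: bound)
    have "(\<lambda>j. d ^ j * ?r) \<longlonglongrightarrow> 0 * ?r"
      by (intro tendsto_mult tendsto_const LIMSEQ_realpow_zero assms)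
    then have small: "\<exists>j. d ^ j * ?r < e" if "e > 0" for e
      using order_tendstoD(2)[of _ "0 * ?r" sequentially e] that by (auto simp: eventually_sequentially)
    show ?thesis
    proof (rule order_tendstoI)
      fix e :: real assume "0 < e"
      then obtain j where "d ^ j * ?r < e"
        using small by blast
      then show "\<forall>\<^sub>F n in sequentially. absval (fps_nth h n * x ^ n) < e"
        using ev[of j] by (auto elim: eventually_mono)
    qed (use absval_nonneg in \<open>auto intro: less_le_trans always_eventually\<close>)
  qed
qed

end

lemma summable_ultrametric_iff:
  fixes f :: "nat \<Rightarrow> 'a::{abs_valued_field, complete_space}"
  assumes ultrametric: "\<And>x y :: 'a. absval (x + y) \<le> max (absval x) (absval y)"
  shows "summable f \<longleftrightarrow> (\<lambda>n. absval (f n)) \<longlonglongrightarrow> 0"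
proof
  assume lim: "(\<lambda>n. absval (f n)) \<longlonglongrightarrow> 0"
  have "Cauchy (\<lambda>N. \<Sum>n<N. f n)"
    unfolding Cauchy_altdef
  proof (intro allI impI)
    fix e :: real assume "e > 0"
    then obtain M where M: "\<And>n. n \<ge> M \<Longrightarrow> absval (f n) < e / 2"
      using LIMSEQ_D[OF lim, of "e / 2"] by (auto simp: absval_nonneg)
    have "dist (\<Sum>i<m. f i) (\<Sum>i<n. f i) < e" if "m \<ge> M" "n > m" for m n
    proof -
      have "dist (\<Sum>i<m. f i) (\<Sum>i<n. f i) = absval (\<Sum>i=m..<n. f i)"
        using that unfolding dist_absval
        by (subst absval_minus_commute) (simp add: lessThan_atLeast0 sum_diff_nat_ivl)
      also have "\<dots> \<le> e / 2"
        using M that \<open>e > 0\<close> by (intro absval_sum_le[OF ultrametric]) (auto intro: less_imp_le)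
      also have "\<dots> < e"
        using \<open>e > 0\<close> by simp
      finally show ?thesis .
    qed
    then show "\<exists>M. \<forall>m\<ge>M. \<forall>n>m. dist (\<Sum>i<m. f i) (\<Sum>i<n. f i) < e"
      by blast
  qed
  then show "summable f"
    unfolding summable_iff_convergent by (rule Cauchy_convergent)
qed (rule absval_tendsto_0_of_summable)

section \<open>Small divisors\<close>

lemma absval_one_minus_power_le:
  fixes x :: "'a::abs_valued_field"
  assumes char: "CHAR('a) > 0" and x: "absval x \<le> 1"
  shows "absval (1 - x ^ n) \<le> absval (1 - x)"
proof (induction n)
  case (Suc n)
  have split: "1 - x ^ Suc n = (1 - x) + x * (1 - x ^ n)"
    by (simp add: algebra_simps)
  have "absval (x * (1 - x ^ n)) \<le> 1 * absval (1 - x)"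
    unfolding absval_mult using Suc x by (intro mult_mono) (simp_all add: absval_nonneg)
  then show ?case
    unfolding split using absval_ultrametric[OF char, of "1 - x" "x * (1 - x ^ n)"] by simp
qed (simp add: absval_nonneg)

lemma absval_eq_1_of_near_1:
  fixes x :: "'a::abs_valued_field"
  assumes char: "CHAR('a) > 0" and x: "absval (1 - x) < 1"
  shows "absval x = 1"
  using absval_diff_le_max[OF absval_ultrametric[OF char], of 1 "1 - x"]
    absval_ultrametric[OF char, of x "1 - x"] x by simp

text \<open>
  Choose \<open>s\<close> with \<open>t s = 1 + p u\<close>. Then \<open>1 - x\<^bsup>t s\<^esup> = (1 - x) + x (1 - x\<^sup>u)\<^sup>p\<close>, and the last term is of
  size at most \<open>|1 - x|\<^sup>p\<close>, hence negligible. As \<open>1 - x\<^bsup>t s\<^esup>\<close> is no larger than \<open>1 - x\<^sup>t\<close>, which is no larger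
  than \<open>1 - x\<close>, all three have the same size.
\<close>

lemma absval_one_minus_power_coprime:
  fixes x :: "'a::abs_valued_field"
  assumes char: "CHAR('a) > 0" and x: "absval (1 - x) < 1" and t: "\<not> CHAR('a) dvd t"
  shows "absval (1 - x ^ t) = absval (1 - x)"
proof (cases "x = 1")
  case False
  let ?p = "CHAR('a)"
  have p: "prime ?p"
    using char by (rule prime_CHAR_semidom)
  then have "coprime t ?p"
    using t by (metis coprime_commute prime_imp_coprime)
  then obtain s where s: "[t * s = 1] (mod ?p)"
    using cong_solve_coprime_nat by auto
  then have "t * s \<noteq> 0"
    using prime_gt_1_nat[OF p] by (intro notI) (simp add: cong_def)
  moreover obtain u where "t * s - 1 = ?p * u"
    using cong_to_1_nat[OF s] by (auto elim: dvdE)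
  ultimately have "t * s = u * ?p + 1"
    by (cases "t * s") (simp_all add: mult.commute[of u])
  then have u: "x ^ (t * s) = x * (x ^ u) ^ ?p"
    by (simp only: power_add power_mult power_one_right mult.commute)
  have [simp]: "absval x = 1"
    using char x by (rule absval_eq_1_of_near_1)
  have "absval (1 - x) > 0"
    using False by (intro absval_pos) simp
  have "(1 - x ^ u) ^ ?p = 1 - (x ^ u) ^ ?p"
    using freshmans_dream[OF p refl, of "1 - x ^ u" "x ^ u"] by (simp add: algebra_simps)
  then have split: "1 - x = (1 - x ^ (t * s)) - x * (1 - x ^ u) ^ ?p"
    unfolding u by (simp add: right_diff_distrib)
  have "absval (1 - x) \<le> max (absval (1 - x ^ (t * s))) (absval (x * (1 - x ^ u) ^ ?p))"
    by (subst split) (rule absval_diff_le_max[OF absval_ultrametric[OF char]])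
  moreover have "absval (x * (1 - x ^ u) ^ ?p) < absval (1 - x)"
  proof -
    have "absval (x * (1 - x ^ u) ^ ?p) \<le> absval (1 - x) ^ ?p"
      using absval_one_minus_power_le[OF char, of x u]
      by (simp add: absval_mult absval_power power_mono absval_nonneg)
    also have "\<dots> < absval (1 - x) ^ 1"
      using \<open>absval (1 - x) > 0\<close> x prime_gt_1_nat[OF p] by (intro power_strict_decreasing) auto
    finally show ?thesis by simp
  qed
  ultimately have "absval (1 - x) \<le> absval (1 - (x ^ t) ^ s)"
    by (simp add: power_mult le_max_iff_disj)
  also have "\<dots> \<le> absval (1 - x ^ t)"
    by (intro absval_one_minus_power_le char) (simp add: absval_power)
  finally show ?thesis
    using absval_one_minus_power_le[OF char, of x t] by simp
qed simp

context
  fixes lam :: "'a::abs_valued_field"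
  assumes char: "CHAR('a) > 0"
    and near_1: "\<exists>n::nat. n \<ge> 1 \<and> absval (1 - lam ^ n) < 1"
begin

lemma mult_index: "mult_index lam \<ge> 1" "absval (1 - lam ^ mult_index lam) < 1"
  using LeastI_ex[OF near_1] unfolding mult_index_def by auto

lemma absval_multiplier: "absval lam = 1"
proof -
  have "absval lam ^ mult_index lam = 1 ^ mult_index lam"
    using absval_eq_1_of_near_1[OF char mult_index(2)] by (simp add: absval_power)
  then show ?thesis
    by (rule power_eq_imp_eq_base) (use mult_index(1) absval_nonneg[of lam] in auto)
qed

lemma absval_one_minus_multiplier_power_le_1: "absval (1 - lam ^ n) \<le> 1"
  using absval_diff_le_max[OF absval_ultrametric[OF char], of 1 "lam ^ n"]
  by (simp add: absval_power absval_multiplier)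

lemma mult_index_dvd:
  assumes "absval (1 - lam ^ n) < 1"
  shows "mult_index lam dvd n"
proof (rule ccontr)
  assume ndvd: "\<not> mult_index lam dvd n"
  define m q r where "m = mult_index lam" and "q = n div m" and "r = n mod m"
  have n: "n = m * q + r"
    by (simp add: q_def r_def)
  have "r \<ge> 1"
    using ndvd by (simp add: r_def m_def dvd_eq_mod_eq_0)
  have "(lam ^ m) ^ q * (1 - lam ^ r) = (1 - lam ^ n) - (1 - (lam ^ m) ^ q)"
    by (simp add: n algebra_simps power_add power_mult)
  then have "absval (1 - lam ^ r) = absval ((1 - lam ^ n) - (1 - (lam ^ m) ^ q))"
    using absval_mult[of "(lam ^ m) ^ q" "1 - lam ^ r"] by (simp add: absval_power absval_multiplier)
  also have "\<dots> \<le> max (absval (1 - lam ^ n)) (absval (1 - (lam ^ m) ^ q))"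
    by (rule absval_diff_le_max[OF absval_ultrametric[OF char]])
  also have "\<dots> < 1"
    using assms mult_index(2) absval_one_minus_power_le[OF char, of "lam ^ m" q]
    by (simp add: m_def absval_power absval_multiplier)
  finally have "m \<le> r"
    using \<open>r \<ge> 1\<close> unfolding m_def mult_index_def by (intro Least_le) simp
  moreover have "r < m"
    using mult_index(1) by (simp add: r_def m_def)
  ultimately show False by simp
qed

text \<open>If \<open>m = p j\<close>, then \<open>1 - \<lambda>\<^sup>m\<close> is the \<open>p\<close>-th power of \<open>1 - \<lambda>\<^sup>j\<close>, against the minimality of \<open>m\<close>.\<close>

lemma not_CHAR_dvd_mult_index: "\<not> CHAR('a) dvd mult_index lam"
proof
  assume "CHAR('a) dvd mult_index lam"
  then obtain j where j: "mult_index lam = CHAR('a) * j" ..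
  have p: "prime CHAR('a)"
    using char by (rule prime_CHAR_semidom)
  have "(1 - lam ^ j) ^ CHAR('a) = 1 - (lam ^ j) ^ CHAR('a)"
    using freshmans_dream[OF p refl, of "1 - lam ^ j" "lam ^ j"] by (simp add: algebra_simps)
  also have "(lam ^ j) ^ CHAR('a) = lam ^ mult_index lam"
    unfolding j by (subst mult.commute) (rule power_mult[symmetric])
  finally have "(1 - lam ^ j) ^ CHAR('a) = 1 - lam ^ mult_index lam" .
  then have "absval (1 - lam ^ j) ^ CHAR('a) < 1"
    using mult_index(2) by (simp flip: absval_power)
  then have "absval (1 - lam ^ j) < 1"
    by (meson not_le one_le_power)
  then have "mult_index lam dvd j"
    by (rule mult_index_dvd)
  then have "CHAR('a) * j \<le> j"
    using mult_index(1) j by (intro dvd_imp_le) (auto intro!: Nat.gr0I)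
  moreover have "j > 0"
    using mult_index(1) j by (intro Nat.gr0I) auto
  ultimately show False
    using prime_gt_1_nat[OF p] by simp
qed

lemma small_divisor:
  assumes "\<not> CHAR('a) dvd n"
  shows "absval (1 - lam ^ n) = (if mult_index lam dvd n then absval (1 - lam ^ mult_index lam) else 1)"
proof (cases "mult_index lam dvd n")
  case True
  then obtain t where t: "n = mult_index lam * t" ..
  then have "\<not> CHAR('a) dvd t"
    using assms by auto
  then show ?thesis
    using True absval_one_minus_power_coprime[OF char mult_index(2)] by (simp add: t power_mult)
next
  case False
  then have "\<not> absval (1 - lam ^ n) < 1"
    using mult_index_dvd by blast
  then show ?thesis
    using False absval_one_minus_multiplier_power_le_1[of n] by simp
qed

lemma resonance_index:
  "resonance_index lam \<ge> 1" "CHAR('a) dvd resonance_index lam" "mult_index lam dvd resonance_index lam - 1"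
proof -
  have "coprime (mult_index lam) CHAR('a)"
    using not_CHAR_dvd_mult_index prime_CHAR_semidom[OF char]
    by (metis coprime_commute prime_imp_coprime)
  then obtain x where x: "[x = 1] (mod mult_index lam)" "[x = 0] (mod CHAR('a))"
    using binary_chinese_remainder_nat by blast
  define k where "k = x + mult_index lam * CHAR('a)"
  have "[k = 1] (mod mult_index lam)"
    using x(1) by (simp add: k_def cong_def)
  then have "mult_index lam dvd k - 1"
    by (rule cong_to_1_nat)
  moreover have "CHAR('a) dvd k"
    using x(2) by (simp add: k_def cong_0_iff)
  moreover have "k \<ge> 1"
    using mult_index(1) char by (simp add: k_def Suc_le_eq)
  ultimately have "\<exists>k. k \<ge> 1 \<and> CHAR('a) dvd k \<and> mult_index lam dvd k - 1"
    by blast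
  from LeastI_ex[OF this]
  show "resonance_index lam \<ge> 1" "CHAR('a) dvd resonance_index lam" "mult_index lam dvd resonance_index lam - 1"
    unfolding resonance_index_def by auto
qed

lemma resonance_index_ge_2: "resonance_index lam \<ge> 2"
  using resonance_index prime_gt_1_nat[OF prime_CHAR_semidom[OF char]] 
    dvd_imp_le[of "CHAR('a)" "resonance_index lam"] by simp

lemma resonant_dvd_diff:
  assumes "CHAR('a) dvd k" "mult_index lam dvd k - 1" "resonance_index lam \<le> k"
  shows "mult_index lam * CHAR('a) dvd k - resonance_index lam"
proof (rule divides_mult)
  show "coprime (mult_index lam) CHAR('a)"
    using not_CHAR_dvd_mult_index prime_CHAR_semidom[OF char]
    by (metis coprime_commute prime_imp_coprime)
  have "mult_index lam dvd (k - 1) - (resonance_index lam - 1)"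
    by (intro dvd_diff_nat assms resonance_index)
  then show "mult_index lam dvd k - resonance_index lam"
    using resonance_index(1) by (simp add: diff_diff_left)
qed (intro dvd_diff_nat assms resonance_index)

end

section \<open>The coefficients of the conjugacy function\<close>

text \<open>At the lowest exponent \<open>n \<ge> 1\<close> that occurs in \<open>u\<close>, invariance reads \<open>\<lambda>\<^sup>n u\<^sub>n = u\<^sub>n\<close>.\<close>

lemma invariant_fps_const:
  fixes f u :: "'a::idom fps"
  assumes f: "fps_nth f 0 = 0" and root: "\<And>n. n \<ge> 1 \<Longrightarrow> fps_nth f 1 ^ n \<noteq> 1"
    and inv: "u oo f = u" and "n \<ge> 1"
  shows "fps_nth u n = 0"
  using \<open>n \<ge> 1\<close>
proof (induction n rule: less_induct)
  case (less n)
  have "(\<Sum>l<n. fps_nth u l * fps_nth (f ^ l) n) = 0"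
  proof (rule sum.neutral, rule ballI)
    fix l assume "l \<in> {..<n}"
    then show "fps_nth u l * fps_nth (f ^ l) n = 0"
      using less by (cases "l = 0") auto
  qed
  then have "fps_nth u n = fps_nth u n * fps_nth f 1 ^ n"
    using arg_cong[OF inv, of "\<lambda>F. fps_nth F n"]
    by (simp add: fps_compose_nth atLeast0AtMost flip: lessThan_Suc_atMost add: startsby_zero_power_nth_same[OF f])
  then have "fps_nth u n * (1 - fps_nth f 1 ^ n) = 0"
    by (simp add: algebra_simps)
  then show ?case
    using root[OF less.prems] by simp
qed

lemma conjugacy_function_recursion:
  assumes conj: "is_conjugacy_function lam f g" and f: "fps_nth f 0 = 0" "fps_nth f 1 = lam" and "n \<ge> 1"
  shows "lam * (1 - lam ^ (n - 1)) * fps_nth g n = (\<Sum>l<n. fps_nth g l * fps_nth (f ^ l) n)"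
proof -
  have "lam * fps_nth g n = fps_nth (g oo f) n"
    using conj by (simp add: is_conjugacy_function_def)
  also have "\<dots> = (\<Sum>l<n. fps_nth g l * fps_nth (f ^ l) n) + fps_nth g n * lam ^ n"
    by (simp add: fps_compose_nth atLeast0AtMost flip: lessThan_Suc_atMost
        add: startsby_zero_power_nth_same[OF f(1)] f(2)[simplified])
  finally show ?thesis
    using \<open>n \<ge> 1\<close> by (cases n) (simp_all add: algebra_simps)
qed

text \<open>
  The derivative of \<open>f\<close> is the constant \<open>\<lambda>\<close>, since the exponents above 1 are multiples of \<open>p\<close>. Differentiating
  the functional equation shows that the derivative of \<open>g\<close> is invariant under \<open>f\<close>, hence constant.
\<close>

lemma conjugacy_function_coeff_eq_0:
  fixes f g :: "'a::abs_valued_field fps"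
  assumes conj: "is_conjugacy_function lam f g" and f: "fps_nth f 0 = 0" "fps_nth f 1 = lam"
    and root: "\<And>n. n \<ge> 1 \<Longrightarrow> lam ^ n \<noteq> 1" and "lam \<noteq> 0"
    and exponents: "\<And>i. i \<ge> 2 \<Longrightarrow> \<not> CHAR('a) dvd i \<Longrightarrow> fps_nth f i = 0"
    and n: "n \<ge> 2" "\<not> CHAR('a) dvd n"
  shows "fps_nth g n = 0"
proof -
  have "fps_deriv f = fps_const lam"
  proof (rule fps_ext)
    fix i
    show "fps_nth (fps_deriv f) i = fps_nth (fps_const lam) i"
    proof (cases "i = 0")
      case False
      then show ?thesis
        using exponents[of "Suc i"]
        by (cases "CHAR('a) dvd Suc i") (auto simp: of_nat_eq_0_iff_char_dvd simp del: of_nat_Suc)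
    qed (use f in simp)
  qed
  then have "(fps_deriv g oo f) * fps_const lam = fps_deriv g * fps_const lam"
    using arg_cong[of _ _ fps_deriv, OF conj[unfolded is_conjugacy_function_def, THEN conjunct2, THEN conjunct2]]
    by (simp add: fps_compose_deriv[OF f(1)] mult.commute)
  then have "fps_deriv g oo f = fps_deriv g"
    using \<open>lam \<noteq> 0\<close> by simp
  then have "fps_nth (fps_deriv g) (n - 1) = 0"
    using invariant_fps_const[OF f(1), of "fps_deriv g" "n - 1"] root f(2) n by simp
  then have "of_nat n * fps_nth g n = 0"
    using n by simp
  then show ?thesis
    using n(2) by (simp add: of_nat_eq_0_iff_char_dvd)
qed

text \<open>
  Write \<open>\<epsilon> = |1 - \<lambda>\<^sup>m|\<close>. Beyond 1, only exponents \<open>n\<close> divisible by \<open>p\<close> occur in \<open>g\<close>. For these the divisor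
  \<open>1 - \<lambda>\<^bsup>n-1\<^esup>\<close> is either of size 1 or of size exactly \<open>\<epsilon>\<close>, the latter when \<open>n\<close> is congruent to \<open>k'\<close>
  modulo \<open>m p\<close>. As the nonlinear terms of \<open>f\<close> start beyond \<open>k'\<close>, the factor \<open>1/\<epsilon>\<close> is picked up for the first time
  at \<open>k' + m p\<close>, so at most \<open>(n - k') div (m p)\<close> times up to \<open>n\<close>.
\<close>

lemma conjugacy_function_coeff_bound:
  fixes f g :: "'a::abs_valued_field fps"
  assumes char: "CHAR('a) > 0"
    and near_1: "\<exists>n::nat. n \<ge> 1 \<and> absval (1 - lam ^ n) < 1"
    and root: "\<And>n. n \<ge> 1 \<Longrightarrow> lam ^ n \<noteq> 1"
    and conj: "is_conjugacy_function lam f g" and f: "fps_nth f 0 = 0" "fps_nth f 1 = lam"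
    and exponents: "\<And>i. i \<ge> 2 \<Longrightarrow> \<not> CHAR('a) dvd i \<Longrightarrow> fps_nth f i = 0"
    and low: "\<And>i. 2 \<le> i \<Longrightarrow> i \<le> resonance_index lam \<Longrightarrow> fps_nth f i = 0"
    and "a > 0" and size: "\<And>i. i \<ge> 1 \<Longrightarrow> absval (fps_nth f i) \<le> a ^ (i - 1)"
  defines "e n \<equiv> (n - resonance_index lam) div (mult_index lam * CHAR('a))"
  shows "2 \<le> n \<Longrightarrow> n \<le> resonance_index lam \<Longrightarrow> fps_nth g n = 0"
    and "n \<ge> 1 \<Longrightarrow> absval (fps_nth g n) * absval (1 - lam ^ mult_index lam) ^ e n \<le> a ^ (n - 1)"
proof -
  let ?k = "resonance_index lam" and ?m = "mult_index lam" and ?p = "CHAR('a)"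
  define eps where "eps = absval (1 - lam ^ ?m)"
  have eps: "0 \<le> eps" "eps < 1"
    using mult_index(2)[OF char near_1] by (simp_all add: eps_def absval_nonneg)
  have lam: "absval lam = 1"
    using char near_1 by (rule absval_multiplier)
  then have "lam \<noteq> 0" by auto
  have g: "fps_nth g 0 = 0" "fps_nth g 1 = 1"
    using conj by (simp_all add: is_conjugacy_function_def)
  note rec = conjugacy_function_recursion[OF conj f]
  show low_g: "fps_nth g n = 0" if "2 \<le> n" "n \<le> ?k" for n
    using that
  proof (induction n rule: less_induct)
    case (less n)
    have "fps_nth g l * fps_nth (f ^ l) n = 0" if "l < n" for l
    proof -
      consider "l = 0" | "l = 1" | "l \<ge> 2" by linarith
      then show ?thesis
        by cases (use g low less that in auto)
    qed
    then have "(\<Sum>l<n. fps_nth g l * fps_nth (f ^ l) n) = 0"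
      by (intro sum.neutral) blast
    then have "lam * (1 - lam ^ (n - 1)) * fps_nth g n = 0"
      using rec[of n] less.prems by simp
    then show ?case
      using root[of "n - 1"] less.prems \<open>lam \<noteq> 0\<close> by auto
  qed
  have power: "absval (fps_nth (f ^ l) n) \<le> a ^ (n - l)" if "l \<le> n" for l n
  proof -
    have "absval (fps_nth f i) * (1 / a) ^ i \<le> 1 / a" for i
      using size[of i] \<open>a > 0\<close> f(1) by (cases i) (simp_all add: field_simps)
    then have "absval (fps_nth (f ^ l) n) * (1 / a) ^ n \<le> (1 / a) ^ l"
      using \<open>a > 0\<close> by (intro gauss_norm_power_le[OF absval_ultrametric[OF char]]) simp_all
    then show ?thesis
      using that \<open>a > 0\<close> by (simp add: power_diff field_simps)
  qed
  have "absval (fps_nth g n) * eps ^ e n \<le> a ^ (n - 1)" if "n \<ge> 1" for n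
    using that
  proof (induction n rule: less_induct)
    case (less n)
    consider "n = 1" | "n \<ge> 2" "fps_nth g n = 0" | "n \<ge> 2" "fps_nth g n \<noteq> 0"
      using less.prems by linarith
    then show ?case
    proof cases
      case 1
      then show ?thesis
        using g eps by (simp add: power_le_one)
    next
      case 2
      then show ?thesis
        using \<open>a > 0\<close> by simp
    next
      case 3
      have "?k < n"
        using low_g[of n] 3 by force
      have pn: "?p dvd n"
        using conjugacy_function_coeff_eq_0[OF conj f root \<open>lam \<noteq> 0\<close> exponents, of n] 3 by blast
      have "\<not> ?p dvd n - 1"
        using pn 3 prime_gt_1_nat[OF prime_CHAR_semidom[OF char]]
        by (metis One_nat_def Suc_1 Suc_leD dvd_diffD1 nat_dvd_1_iff_1 nat_neq_iff)
      note divisor = small_divisor[OF char near_1 this]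
      (* The exponent of eps that remains once the divisor at n has used up its own factor. *)
      define e' where "e' = e n - (if ?m dvd n - 1 then 1 else 0)"
      have mp: "?m * ?p > 0"
        using mult_index(1)[OF char near_1] char by simp
      have e_mono: "e l \<le> e n" if "l \<le> n" for l
        unfolding e_def using that by (intro div_le_mono diff_le_mono)
      have e': "e l \<le> e'" if "l < n" for l
      proof (cases "?m dvd n - 1")
        case True
        then have "?m * ?p dvd n - ?k"
          using resonant_dvd_diff[OF char near_1 pn] \<open>?k < n\<close> by simp
        then obtain j where j: "n - ?k = (?m * ?p) * j" ..
        then have "e n = j" "j > 0"
          using mp \<open>?k < n\<close> by (simp_all add: e_def) (auto intro!: Nat.gr0I)
        have "l - ?k < j * (?m * ?p)"
          using that j \<open>?k < n\<close> by (simp add: mult.commute)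
        then have "e l < j"
          unfolding e_def using mp by (simp add: div_less_iff_less_mult)
        then show ?thesis
          using True \<open>e n = j\<close> by (simp add: e'_def)
      qed (use e_mono that in \<open>simp add: e'_def\<close>)
      have e_pos: "e n \<ge> 1" if "?m dvd n - 1"
      proof -
        have "?m * ?p dvd n - ?k"
          using resonant_dvd_diff[OF char near_1 pn that] \<open>?k < n\<close> by simp
        then have "?m * ?p \<le> n - ?k"
          using \<open>?k < n\<close> by (intro dvd_imp_le) auto
        then show ?thesis
          using mp unfolding e_def by (simp add: div_greater_zero_iff Suc_le_eq)
      qed
      have "absval (1 - lam ^ (n - 1)) * eps ^ e' = eps ^ e n"
      proof (cases "?m dvd n - 1")
        case True
        then have "e n = Suc e'"
          using e_pos by (simp add: e'_def)
        then show ?thesis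
          using True divisor by (simp add: eps_def)
      qed (use divisor in \<open>simp add: e'_def\<close>)
      then have "absval (fps_nth g n) * eps ^ e n
          = absval (lam * (1 - lam ^ (n - 1)) * fps_nth g n) * eps ^ e'"
        by (simp add: absval_mult lam mult_ac)
      also have "\<dots> = absval (\<Sum>l<n. fps_nth g l * fps_nth (f ^ l) n * (1 - lam ^ ?m) ^ e')"
        unfolding rec[OF less.prems] eps_def
        by (simp only: sum_distrib_right[symmetric] absval_mult absval_power)
      also have "\<dots> \<le> a ^ (n - 1)"
      proof (rule absval_sum_le[OF absval_ultrametric[OF char]])
        fix l assume "l \<in> {..<n}"
        then have "l < n" by simp
        show "absval (fps_nth g l * fps_nth (f ^ l) n * (1 - lam ^ ?m) ^ e') \<le> a ^ (n - 1)"
        proof (cases "l = 0")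
          case False
          have "absval (fps_nth g l) * eps ^ e' \<le> absval (fps_nth g l) * eps ^ e l"
            using e'[OF \<open>l < n\<close>] eps by (intro mult_left_mono power_decreasing absval_nonneg) auto
          also have "\<dots> \<le> a ^ (l - 1)"
            using less.IH[OF \<open>l < n\<close>] False by simp
          finally have "(absval (fps_nth g l) * eps ^ e') * absval (fps_nth (f ^ l) n) \<le> a ^ (l - 1) * a ^ (n - l)"
            using power[of l n] \<open>l < n\<close> \<open>a > 0\<close> by (intro mult_mono) (simp_all add: absval_nonneg)
          also have "\<dots> = a ^ (n - 1)"
            using False \<open>l < n\<close> by (simp flip: power_add)
          finally show ?thesis
            by (simp add: absval_mult absval_power eps_def mult_ac)
        qed (use g \<open>a > 0\<close> in simp)
      qed (use \<open>a > 0\<close> in simp)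
      finally show ?thesis .
    qed
  qed
  then show "n \<ge> 1 \<Longrightarrow> absval (fps_nth g n) * absval (1 - lam ^ ?m) ^ e n \<le> a ^ (n - 1)"
    by (simp add: eps_def)
qed

section \<open>Full conjugacy\<close>

text \<open>
  The power series identities satisfied by \<open>h = g\<^sup>-\<^sup>1\<close> and \<open>f\<close> are to be read between values at a point \<open>x\<close>.
  Put \<open>R = |x|\<close>. The terms of \<open>g\<close> and \<open>h\<close> at radius \<open>R\<close> are bounded by \<open>R\<close> and tend to zero, and those of
  \<open>f\<close> at \<open>h x\<close> are bounded by \<open>R\<close>. Hence no value met on the way leaves the disc of radius \<open>R\<close>, and each
  composite may be evaluated termwise.
\<close>

lemma full_conjugacy_on_of_near_identity:
  fixes f g :: "'a::{abs_valued_field, complete_space} fps"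
  assumes char: "CHAR('a) > 0"
    and conj: "is_conjugacy_function lam f g" and f0: "fps_nth f 0 = 0"
    and d: "0 \<le> d" "d < 1"
    and near: "\<And>x n. x \<in> U \<Longrightarrow> n \<ge> 2 \<Longrightarrow> absval (fps_nth g n * x ^ n) \<le> d * absval x"
    and conv: "fps_converges_on g U"
    and f_bound: "\<And>x y n. x \<in> U \<Longrightarrow> absval y \<le> absval x \<Longrightarrow> absval (fps_nth f n * y ^ n) \<le> absval x"
    and f_conv: "\<And>x y. x \<in> U \<Longrightarrow> absval y \<le> absval x \<Longrightarrow> summable (\<lambda>n. fps_nth f n * y ^ n)"
  shows "full_conjugacy_on lam f g U"
proof -
  define h where "h = fps_inv g"
  note ultra = absval_ultrametric[OF char]
  have g: "fps_nth g 0 = 0" "fps_nth g 1 = 1" and fg: "g oo f = fps_const lam * g"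
    using conj by (simp_all add: is_conjugacy_function_def)
  have hg: "h oo g = fps_X" and gh: "g oo h = fps_X"
    unfolding h_def using g by (simp_all add: fps_inv fps_inv_right)
  have h0: "fps_nth h 0 = 0"
    using arg_cong[OF hg, of "\<lambda>F. fps_nth F 0"] by simp
  have X: "(\<lambda>n. fps_nth fps_X n * x ^ n) sums x" for x :: 'a
  proof -
    have "(\<lambda>n. fps_nth fps_X n * x ^ n) = (\<lambda>n. if n = 1 then x else 0)"
      by auto
    then show ?thesis
      using sums_single[of 1 "\<lambda>_. x"] by simp
  qed
  have evaluated: "(\<lambda>n. fps_nth F n * y ^ n) sums fps_eval F y"
    if "(\<lambda>n. absval (fps_nth F n) * R ^ n) \<longlonglongrightarrow> 0" "absval y \<le> R" for F :: "'a fps" and y R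
  proof -
    have "(\<lambda>n. absval (fps_nth F n * y ^ n)) \<longlonglongrightarrow> 0"
    proof (rule tendsto_0_le[OF that(1), of _ 1])
      show "\<forall>\<^sub>F n in sequentially. norm (absval (fps_nth F n * y ^ n)) \<le> norm (absval (fps_nth F n) * R ^ n) * 1"
        using that(2) by (intro always_eventually allI)
          (auto simp: absval_mult absval_power absval_nonneg intro!: mult_left_mono power_mono order_trans[OF _ abs_ge_self])
    qed
    then show ?thesis
      unfolding fps_eval_def by (intro summable_sums) (simp add: summable_ultrametric_iff[OF ultra])
  qed
  have at_point: "summable (\<lambda>n. fps_nth h n * x ^ n) \<and>
      fps_eval h (fps_eval g x) = x \<and> absval (fps_eval h x) \<le> absval x \<and>
      summable (\<lambda>n. fps_nth g n * fps_eval f (fps_eval h x) ^ n) \<and>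
      fps_eval g (fps_eval f (fps_eval h x)) = lam * x" if "x \<in> U" for x
  proof -
    let ?R = "absval x"
    have g_sums: "(\<lambda>n. fps_nth g n * x ^ n) sums fps_eval g x"
      using conv that by (auto simp: fps_converges_on_def fps_eval_def intro: summable_sums)
    have g_null: "(\<lambda>n. absval (fps_nth g n) * ?R ^ n) \<longlonglongrightarrow> 0"
      using absval_tendsto_0_of_summable[OF sums_summable[OF g_sums]] by (simp add: absval_mult absval_power)
    have g_bound: "absval (fps_nth g n * x ^ n) \<le> ?R" for n
    proof -
      have "d * ?R \<le> ?R"
        using d by (simp add: mult_left_le_one_le absval_nonneg)
      then have "absval (fps_nth g n * x ^ n) \<le> ?R" if "n \<ge> 2"
        using near[OF \<open>x \<in> U\<close> that] by simp
      moreover have "n = 0 \<or> n = 1 \<or> n \<ge> 2" by linarith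
      ultimately show ?thesis
        using g absval_nonneg[of x] by auto
    qed
    note inverse = inverse_near_identity[OF ultra g hg d near[OF that] g_sums]
    have h_null: "(\<lambda>n. absval (fps_nth h n) * ?R ^ n) \<longlonglongrightarrow> 0"
      using inverse(2) by (simp add: absval_mult absval_power)
    note h_sums = evaluated[OF h_null order_refl]
    have gx: "absval (fps_eval g x) \<le> ?R"
      by (rule absval_sums_le[OF ultra g_sums g_bound absval_nonneg])
    have "(\<lambda>n. fps_nth (h oo g) n * x ^ n) sums fps_eval h (fps_eval g x)"
      by (rule sums_fps_compose[OF ultra g(1) absval_nonneg g_sums g_bound h_null evaluated[OF h_null gx]])
    then have left: "fps_eval h (fps_eval g x) = x"
      unfolding hg using X sums_unique2 by blast
    define y where "y = fps_eval h x"
    have y: "absval y \<le> ?R"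
      unfolding y_def by (rule absval_sums_le[OF ultra h_sums inverse(1) absval_nonneg])
    have "(\<lambda>n. fps_nth (g oo h) n * x ^ n) sums fps_eval g y"
      unfolding y_def
      by (rule sums_fps_compose[OF ultra h0 absval_nonneg h_sums inverse(1) g_null
            evaluated[OF g_null y[unfolded y_def]]])
    then have right: "fps_eval g y = x"
      unfolding gh using X sums_unique2 by blast
    have f_sums: "(\<lambda>n. fps_nth f n * y ^ n) sums fps_eval f y"
      using f_conv[OF that y] by (simp add: fps_eval_def summable_sums)
    have fy: "absval (fps_eval f y) \<le> ?R"
      by (rule absval_sums_le[OF ultra f_sums f_bound[OF that y] absval_nonneg])
    note g_fy = evaluated[OF g_null fy]
    have "(\<lambda>n. fps_nth (g oo f) n * y ^ n) sums fps_eval g (fps_eval f y)"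
      by (rule sums_fps_compose[OF ultra f0 absval_nonneg f_sums f_bound[OF that y] g_null g_fy])
    moreover have "(\<lambda>n. fps_nth (g oo f) n * y ^ n) sums (lam * fps_eval g y)"
      unfolding fg using sums_cmult[OF evaluated[OF g_null y], of lam] by (simp add: mult.assoc)
    ultimately have "fps_eval g (fps_eval f y) = lam * x"
      using sums_unique2 right by metis
    then show ?thesis
      using left y h_sums g_fy by (simp add: y_def sums_summable)
  qed
  have "inj_on (fps_eval g) U"
    by (rule inj_on_inverseI[of _ "fps_eval h"]) (use at_point in blast)
  then show ?thesis
    unfolding full_conjugacy_on_def fps_converges_on_def h_def[symmetric]
    using at_point f_conv conv by (auto simp: fps_converges_on_def)
qed

lemma series_family_coeff_le:
  assumes "f \<in> series_family lam a" "i \<ge> 2"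
  shows "absval (fps_nth f i) \<le> a ^ (i - 1)"
proof -
  have le: "absval (fps_nth f i) powr (1 / (real i - 1)) \<le> a"
    using assms cSUP_upper[of i "{2..}" "\<lambda>i. absval (fps_nth f i) powr (1 / (real i - 1))"]
    by (simp add: series_family_def)
  have "absval (fps_nth f i) = (absval (fps_nth f i) powr (1 / (real i - 1))) ^ (i - 1)"
  proof (cases "fps_nth f i = 0")
    case False
    then have "0 < absval (fps_nth f i)"
      by (rule absval_pos)
    then show ?thesis
      using assms(2) by (simp add: powr_powr of_nat_diff flip: powr_realpow)
  qed (use assms(2) in \<open>simp add: power_0_left\<close>)
  also have "\<dots> \<le> a ^ (i - 1)"
    by (intro power_mono le) simp
  finally show ?thesis .
qed

text \<open>For \<open>f\<close> this is used with \<open>r = 1/a\<close>, for \<open>g\<close> with \<open>r = \<rho>\<close>.\<close>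

lemma geometric_majorant:
  fixes F :: "'a::{abs_valued_field, complete_space} fps"
  assumes char: "CHAR('a) > 0"
    and F: "fps_nth F 0 = 0" "\<And>n. n \<ge> 1 \<Longrightarrow> absval (fps_nth F n) * r ^ (n - 1) \<le> 1"
    and "0 < r"
  shows "absval x \<le> r \<Longrightarrow> absval (fps_nth F n * x ^ n) \<le> absval x"
    and "absval x < r \<Longrightarrow> summable (\<lambda>n. fps_nth F n * x ^ n)"
proof -
  have geometric: "absval (fps_nth F n * x ^ n) \<le> absval x * (absval x / r) ^ (n - 1)" if "n \<ge> 1" for n
  proof -
    obtain k where n: "n = Suc k"
      using \<open>n \<ge> 1\<close> by (cases n) auto
    have "absval (fps_nth F n * x ^ n) = (absval (fps_nth F n) * r ^ (n - 1)) * (absval x * (absval x / r) ^ (n - 1))"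
      using \<open>0 < r\<close> by (simp add: n absval_mult absval_power power_divide)
    also have "\<dots> \<le> 1 * (absval x * (absval x / r) ^ (n - 1))"
      using \<open>0 < r\<close> by (intro mult_right_mono F that) (simp add: absval_nonneg)
    finally show ?thesis by simp
  qed
  show "absval (fps_nth F n * x ^ n) \<le> absval x" if "absval x \<le> r"
  proof (cases "n = 0")
    case False
    have "absval x * (absval x / r) ^ (n - 1) \<le> absval x * 1"
      using that \<open>0 < r\<close> by (intro mult_left_mono power_le_one) (simp_all add: absval_nonneg)
    then show ?thesis
      using geometric[of n] False by simp
  qed (use F absval_nonneg in simp)
  show "summable (\<lambda>n. fps_nth F n * x ^ n)" if "absval x < r"
    unfolding summable_ultrametric_iff[OF absval_ultrametric[OF char]]
  proof (rule LIMSEQ_imp_Suc, rule tendsto_sandwich[where f = "\<lambda>_. 0"])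
    have "(\<lambda>n. absval x * (absval x / r) ^ n) \<longlonglongrightarrow> absval x * 0"
      using that \<open>0 < r\<close> by (intro tendsto_mult_left LIMSEQ_realpow_zero) (simp_all add: absval_nonneg)
    then show "(\<lambda>n. absval x * (absval x / r) ^ n) \<longlonglongrightarrow> 0"
      by simp
    show "\<forall>\<^sub>F n in sequentially. absval (fps_nth F (Suc n) * x ^ Suc n) \<le> absval x * (absval x / r) ^ n"
      using geometric[of "Suc _"] by (intro always_eventually) simp
  qed (auto intro: always_eventually absval_nonneg)
qed

theorem theorem5:
  fixes lam :: "'a :: {abs_valued_field, complete_space}"
    and f g :: "'a fps" and a rho :: real and i0 :: nat
  assumes "CHAR('a) > 0"
    and "\<not> (\<exists>n::nat. n \<ge> 1 \<and> lam ^ n = 1)"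
    and "\<exists>n::nat. n \<ge> 1 \<and> absval (1 - lam ^ n) < 1"
    and "a > 0"
    and "f \<in> series_family lam a"
    and "i0 > resonance_index lam"
    and "\<forall>i. 2 \<le> i \<and> i < i0 \<longrightarrow> fps_nth f i = 0"
    and "is_conjugacy_function lam f g"
    and "rho = absval (1 - lam ^ mult_index lam)
                 powr (1 / (real (mult_index lam) * real CHAR('a))) / a"
  shows "(fps_converges_on g (cball 0 rho) \<longrightarrow>
           (\<exists>U. disc_about_0 U \<and> cball 0 rho \<subseteq> U \<and> full_conjugacy_on lam f g U)) \<and>
         (\<not> fps_converges_on g (cball 0 rho) \<longrightarrow>
           (\<exists>U. disc_about_0 U \<and> ball 0 rho \<subseteq> U \<and> full_conjugacy_on lam f g U))"
proof -
  let ?k = "resonance_index lam" and ?m = "mult_index lam" and ?p = "CHAR('a)"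
  note char = assms(1) and near_1 = assms(3)
  have root: "lam ^ n \<noteq> 1" if "n \<ge> 1" for n
    using assms(2) that by blast
  have f: "fps_nth f 0 = 0" "fps_nth f 1 = lam" "\<And>i. i \<ge> 2 \<Longrightarrow> \<not> ?p dvd i \<Longrightarrow> fps_nth f i = 0"
    using assms(5) by (auto simp: series_family_def)
  have low: "fps_nth f i = 0" if "2 \<le> i" "i \<le> ?k" for i
    using assms(6,7) that by auto
  have f_size: "absval (fps_nth f i) \<le> a ^ (i - 1)" if "i \<ge> 1" for i
    using series_family_coeff_le[OF assms(5), of i] that f(2) absval_multiplier[OF char near_1]
    by (cases "i = 1") auto
  note coeff = conjugacy_function_coeff_bound[OF char near_1 root assms(8) f(1,2) f(3) low assms(4) f_size]
  have m: "?m * ?p > 0"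
    using mult_index(1)[OF char near_1] char by simp
  define eps where "eps = absval (1 - lam ^ ?m)"
  have eps: "0 < eps" "eps < 1"
    using mult_index[OF char near_1] root[of ?m] by (auto simp: eps_def intro!: absval_pos)
  define t where "t = a * rho"
  have t: "t = eps powr (1 / real (?m * ?p))"
    using assms(4,9) by (simp add: t_def eps_def)
  have t_power: "t ^ (?m * ?p) = eps"
    using eps m by (simp add: t powr_powr flip: powr_realpow)
  have t_bounds: "0 < t" "t < 1"
  proof -
    show "0 < t"
      using eps by (simp add: t)
    show "t < 1"
      using t_power eps(2) one_le_power[of t "?m * ?p"] by linarith
  qed
  have rho: "rho > 0" "rho < 1 / a"
    using t_bounds assms(4) by (simp_all add: t_def zero_less_mult_iff field_simps)
  (* The divisors cost g_n at most e factors eps = t^(m p), where m p e \<le> n - k'. Of the n - 1 factors t in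
     (a rho)^(n - 1) at least k' - 1 \<ge> 1 are left over, so g is uniformly close to the identity. *)
  define d where "d = t ^ (?k - 1)"
  have d: "0 \<le> d" "d < 1"
    using t_bounds resonance_index_ge_2[OF char near_1] by (simp_all add: d_def power_less_one_iff)
  have g_size: "absval (fps_nth g n) * rho ^ (n - 1) \<le> d" if "n \<ge> 2" for n
  proof (cases "n \<le> ?k")
    case False
    define e where "e = (n - ?k) div (?m * ?p)"
    have "(?m * ?p) * e \<le> n - ?k"
      by (simp add: e_def)
    then have "(?m * ?p) * e + (?k - 1) \<le> n - 1"
      using False resonance_index_ge_2[OF char near_1] by simp
    then have "t ^ (n - 1) \<le> t ^ ((?m * ?p) * e + (?k - 1))"
      using t_bounds by (intro power_decreasing) auto
    then have "t ^ (n - 1) \<le> eps ^ e * d"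
      by (simp only: power_add power_mult[of t "?m * ?p" e] t_power d_def)
    then have "absval (fps_nth g n) * t ^ (n - 1) \<le> (absval (fps_nth g n) * eps ^ e) * d"
      using mult_left_mono[OF _ absval_nonneg[of "fps_nth g n"]] by (simp add: mult.assoc)
    also have "\<dots> \<le> a ^ (n - 1) * d"
      using coeff(2)[of n] that d by (intro mult_right_mono) (simp_all add: e_def eps_def)
    finally show ?thesis
      using assms(4) by (simp add: t_def power_mult_distrib mult.left_commute)
  qed (use coeff(1)[of n] that d in simp)
  have full: "full_conjugacy_on lam f g U" if "U \<subseteq> cball 0 rho" "fps_converges_on g U" for U
  proof (rule full_conjugacy_on_of_near_identity[OF char assms(8) f(1) d _ that(2)])
    have weighted: "absval (fps_nth f n) * (1 / a) ^ (n - 1) \<le> 1" if "n \<ge> 1" for n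
      using f_size[OF that] assms(4) by (simp add: field_simps)
    have "0 < 1 / a"
      using assms(4) by simp
    note f_majorant = geometric_majorant[OF char f(1) weighted this]
    fix x assume "x \<in> U"
    then have x: "absval x \<le> rho"
      using that(1) by (auto simp: dist_absval)
    show "absval (fps_nth g n * x ^ n) \<le> d * absval x" if "n \<ge> 2" for n
    proof -
      have "absval (fps_nth g n * x ^ n) = (absval (fps_nth g n) * absval x ^ (n - 1)) * absval x"
        using that by (cases n) (simp_all add: absval_mult absval_power)
      also have "\<dots> \<le> (absval (fps_nth g n) * rho ^ (n - 1)) * absval x"
        using x by (intro mult_right_mono mult_left_mono power_mono absval_nonneg)
      also have "\<dots> \<le> d * absval x"
        by (intro mult_right_mono g_size that absval_nonneg)
      finally show ?thesis .
    qed
    fix y :: 'a assume y: "absval y \<le> absval x"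
    show "absval (fps_nth f n * y ^ n) \<le> absval x" for n
      using f_majorant(1)[of y n] x y rho by simp
    show "summable (\<lambda>n. fps_nth f n * y ^ n)"
      using f_majorant(2)[of y] x y rho by simp
  qed
  have "fps_converges_on g (ball 0 rho)"
    unfolding fps_converges_on_def
  proof
    fix x :: 'a assume "x \<in> ball 0 rho"
    then have "absval x < rho"
      by (simp add: dist_absval)
    moreover have "absval (fps_nth g n) * rho ^ (n - 1) \<le> 1" if "n \<ge> 1" for n
      using g_size[of n] d assms(8) that by (cases "n = 1") (auto simp: is_conjugacy_function_def)
    ultimately show "summable (\<lambda>n. fps_nth g n * x ^ n)"
      using geometric_majorant(2)[OF char _ _ rho(1), of g x] assms(8)
      by (simp add: is_conjugacy_function_def)
  qed
  then have "full_conjugacy_on lam f g (ball 0 rho)"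
    by (intro full ball_subset_cball)
  moreover have "disc_about_0 (ball (0::'a) rho)" "disc_about_0 (cball (0::'a) rho)"
    using rho by (auto simp: disc_about_0_def)
  ultimately show ?thesis
    using full by blast
qed

end
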